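(* Let $X$ be a compact metric space with $X^{slc}\neq\emptyset$, and let $f:X\to X$ be a transitive homeomorphism. Then $f$ satisfies property (CW) if and only if $f$ is equicontinuous.
   Context: Let $(X,d)$ be a compact metric space and $f:X\to X$ a homeomorphism; $f^n$ denotes the $n$-th iterate for $n\in\mathbb{Z}$. $f$ is transitive if there is $x\in X$ such that the orbit $\{f^n(x):n\in\mathbb{Z}\}$ is dense in $X$. $f$ is equicontinuous if for every $\epsilon>0$ there is $\delta>0$ such that $d(f^n(x),f^n(y))\leq\epsilon$ for all $n\in\mathbb{Z}$ whenever $x,y\in X$ satisfy $d(x,y)\leq\delta$. For $p\in X$ and nonempty $B\subset X$, $dist(p,B)=\inf\{d(p,b):b\in B\}$. A subcontinuum of $X$ is a nonempty compact connected subset of $X$. $f$ satisfies property (CW) if $\inf_{n\in\mathbb{Z}}dist(f^n(x),f^n(C))>0$ for every $x\in X$ and every subcontinuum $C$ of $X$ with $x\notin C$. $X$ is semi-locally connected at $p\in X$ if for every open neighborhood $U$ of $p$ there is an open neighborhood $V\subset U$ of $p$ such that $X\setminus U$ is contained in the union of finitely many connected components of $X\setminus V$. $X^{slc}$ denotes the set of points at which $X$ is semi-locally connected. *)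

theory Defs
  imports "HOL-Analysis.Analysis"
begin

text \<open>
  A compact metric space is rendered as a compact set \<open>X\<close> in a metric space type, with the
  restricted metric and topology. All notions below depend on \<open>f\<close> only through its
  values on \<open>X\<close>, provided that \<open>f\<close> is a bijection of \<open>X\<close>.
\<close>

definition int_iterate :: "'a set \<Rightarrow> ('a \<Rightarrow> 'a) \<Rightarrow> int \<Rightarrow> 'a \<Rightarrow> 'a" where
  "int_iterate X f n =
     (if n \<ge> 0 then f ^^ nat n else inv_into X f ^^ nat (- n))"

definition transitive_homeo :: "'a::metric_space set \<Rightarrow> ('a \<Rightarrow> 'a) \<Rightarrow> bool" where
  "transitive_homeo X f \<longleftrightarrow>
     (\<exists>x\<in>X. X \<subseteq> closure (range (\<lambda>n. int_iterate X f n x)))"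

definition equicontinuous_homeo :: "'a::metric_space set \<Rightarrow> ('a \<Rightarrow> 'a) \<Rightarrow> bool" where
  "equicontinuous_homeo X f \<longleftrightarrow>
     (\<forall>\<epsilon>>0. \<exists>\<delta>>0. \<forall>x\<in>X. \<forall>y\<in>X. dist x y \<le> \<delta> \<longrightarrow>
        (\<forall>n. dist (int_iterate X f n x) (int_iterate X f n y) \<le> \<epsilon>))"

definition subcontinuum :: "'a::metric_space set \<Rightarrow> 'a set \<Rightarrow> bool" where
  "subcontinuum X C \<longleftrightarrow> C \<subseteq> X \<and> C \<noteq> {} \<and> compact C \<and> connected C"

text \<open>
  \<^const>\<open>infdist\<close> is the usual distance from a point to a nonempty set. It is nonnegative, so the
  real-valued infimum below is one of a nonempty family that is bounded below.
\<close>

definition property_CW :: "'a::metric_space set \<Rightarrow> ('a \<Rightarrow> 'a) \<Rightarrow> bool" where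
  "property_CW X f \<longleftrightarrow>
     (\<forall>x\<in>X. \<forall>C. subcontinuum X C \<and> x \<notin> C \<longrightarrow>
        (INF n. infdist (int_iterate X f n x) (int_iterate X f n ` C)) > 0)"

definition semi_locally_connected_at :: "'a::metric_space set \<Rightarrow> 'a \<Rightarrow> bool" where
  "semi_locally_connected_at X p \<longleftrightarrow>
     (\<forall>U. openin (top_of_set X) U \<and> p \<in> U \<longrightarrow>
        (\<exists>V. openin (top_of_set X) V \<and> p \<in> V \<and> V \<subseteq> U \<and>
           (\<exists>\<F>. finite \<F> \<and> \<F> \<subseteq> components (X - V) \<and> X - U \<subseteq> \<Union>\<F>)))"

definition slc_points :: "'a::metric_space set \<Rightarrow> 'a set" where
  "slc_points X = {p \<in> X. semi_locally_connected_at X p}"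

end

theory Submission
  imports Defs
begin

text \<open>
  Write \<open>F n\<close> for the iterates. Let \<open>p\<close> be a point of semi-local connectedness. Property (CW),
  applied to the finitely many components that cover the complement of a ball around \<open>p\<close>, gives
  for every \<open>\<epsilon>\<close> a \<open>\<delta>\<close> such that \<open>d (F n p) (F n y) < \<delta>\<close> for some \<open>n\<close> forces \<open>d p y < \<epsilon>\<close>. Applied
  to singletons, (CW) says that \<open>f\<close> is distal.

  The expansion estimate at \<open>p\<close> makes every point of the orbit closure of \<open>p\<close> accumulate at \<open>p\<close>. If
  \<open>F n x\<close> approaches \<open>p\<close> and \<open>F (- n) p\<close> approaches \<open>y\<close> along the same \<open>n\<close>, then \<open>F n y\<close> approaches
  \<open>p\<close> too, whence \<open>x = y\<close> by distality; for \<open>x\<close> with dense orbit this makes the orbit of \<open>p\<close>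
  dense. The same estimate shows that only \<open>p\<close> is regionally proximal to \<open>p\<close>. A regionally proximal
  pair can be moved by \<open>F\<close> until its first point is close to \<open>p\<close>, hence so is the second one, and
  distality makes them equal. Finally, a failure of equicontinuity would produce a nontrivial
  regionally proximal pair.
\<close>

section \<open>Integer actions by continuous maps on a compact set\<close>

locale compact_int_action =
  fixes X :: "'a::metric_space set" and F :: "int \<Rightarrow> 'a \<Rightarrow> 'a"
  assumes compact_X: "compact X"
    and zero: "x \<in> X \<Longrightarrow> F 0 x = x"
    and add: "x \<in> X \<Longrightarrow> F (m + n) x = F m (F n x)"
    and closed: "x \<in> X \<Longrightarrow> F n x \<in> X"
    and cont: "continuous_on X (F n)"
begin

lemma inverse [simp]:
  assumes "x \<in> X"
  shows "F (- n) (F n x) = x" "F n (F (- n) x) = x"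
  using add[OF assms, of "- n" n] add[OF assms, of n "- n"] zero[OF assms] by simp_all

lemma cont_at:
  assumes "x \<in> X" "\<epsilon> > 0"
  obtains \<delta> where "\<delta> > 0" "\<And>y. y \<in> X \<Longrightarrow> dist y x < \<delta> \<Longrightarrow> dist (F n y) (F n x) < \<epsilon>"
  using cont[of n] assms unfolding continuous_on_iff by blast

text \<open>Membership of \<open>y\<close> in the closure of the orbit of \<open>x\<close>: points
  of the orbit itself count, and no infinitely many returns are asked for.\<close>

definition accumulates_at :: "'a \<Rightarrow> 'a \<Rightarrow> bool" where
  "accumulates_at x y \<longleftrightarrow> (\<forall>\<epsilon>>0. \<exists>n. dist (F n x) y < \<epsilon>)"

definition proximal :: "'a \<Rightarrow> 'a \<Rightarrow> bool" where
  "proximal x y \<longleftrightarrow> (\<forall>\<epsilon>>0. \<exists>n. dist (F n x) (F n y) < \<epsilon>)"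

definition distal :: bool where
  "distal \<longleftrightarrow> (\<forall>x\<in>X. \<forall>y\<in>X. proximal x y \<longrightarrow> x = y)"

text \<open>Read backwards, this is equicontinuity along the orbit of \<open>p\<close>: a point
  \<open>\<delta>\<close>-close to \<open>F n p\<close> is brought \<open>\<epsilon>\<close>-close
  to \<open>p\<close> by \<open>F (- n)\<close>, with \<open>\<delta>\<close> independent of
  \<open>n\<close>.\<close>

definition uniformly_separated :: "'a \<Rightarrow> bool" where
  "uniformly_separated p \<longleftrightarrow>
     (\<forall>\<epsilon>>0. \<exists>\<delta>>0. \<forall>n. \<forall>y\<in>X. dist (F n p) (F n y) < \<delta> \<longrightarrow> dist p y < \<epsilon>)"

text \<open>The classical relation of topological dynamics: the pair lies, for every
  \<open>\<epsilon>\<close>, in the closure of the set of pairs that some iterate brings within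
  \<open>\<epsilon>\<close>.\<close>

definition regionally_proximal :: "'a \<Rightarrow> 'a \<Rightarrow> bool" where
  "regionally_proximal x y \<longleftrightarrow>
     (\<forall>\<epsilon>>0. \<exists>u\<in>X. \<exists>v\<in>X. \<exists>n. dist u x < \<epsilon> \<and> dist v y < \<epsilon> \<and> dist (F n u) (F n v) < \<epsilon>)"

section \<open>Orbit closures and a point of uniform separation\<close>

lemma uniformly_separatedE:
  assumes "uniformly_separated p" "\<epsilon> > 0"
  obtains \<delta> where "\<delta> > 0"
    "\<And>n y. y \<in> X \<Longrightarrow> dist (F n p) (F n y) < \<delta> \<Longrightarrow> dist p y < \<epsilon>"
  using assms unfolding uniformly_separated_def by blast

lemma accumulates_at_trans:
  assumes "x \<in> X" "y \<in> X" "accumulates_at x y" "accumulates_at y z"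
  shows "accumulates_at x z"
  unfolding accumulates_at_def
proof (intro allI impI)
  fix \<epsilon> :: real assume "\<epsilon> > 0"
  then obtain n where n: "dist (F n y) z < \<epsilon> / 2"
    using assms(4) unfolding accumulates_at_def by (meson half_gt_zero)
  obtain \<delta> where \<delta>: "\<delta> > 0" "\<And>u. u \<in> X \<Longrightarrow> dist u y < \<delta> \<Longrightarrow> dist (F n u) (F n y) < \<epsilon> / 2"
    using cont_at[OF assms(2), of "\<epsilon> / 2" n] \<open>\<epsilon> > 0\<close> by auto
  obtain m where "dist (F m x) y < \<delta>"
    using assms(3) \<delta>(1) unfolding accumulates_at_def by blast
  then have "dist (F (n + m) x) (F n y) < \<epsilon> / 2"
    using \<delta>(2)[OF closed[OF assms(1)]] add[OF assms(1)] by simp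
  then have "dist (F (n + m) x) z < \<epsilon>"
    using n by (metis dist_triangle_half_r dist_commute)
  then show "\<exists>n. dist (F n x) z < \<epsilon>" ..
qed

text \<open>Once \<open>F m p\<close> is near \<open>z = F m (F (- m) z)\<close>, separation pulls
  this back by \<open>F (- m)\<close>, so the point \<open>F (- m) z\<close> of the orbit of
  \<open>z\<close> is near \<open>p\<close>.\<close>

lemma uniformly_separated_recurrent:
  assumes p: "p \<in> X" "uniformly_separated p" and z: "z \<in> X" "accumulates_at p z"
  shows "accumulates_at z p"
  unfolding accumulates_at_def
proof (intro allI impI)
  fix \<epsilon> :: real assume "\<epsilon> > 0"
  then obtain \<delta> where \<delta>: "\<delta> > 0"
    "\<And>n y. y \<in> X \<Longrightarrow> dist (F n p) (F n y) < \<delta> \<Longrightarrow> dist p y < \<epsilon>"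
    using p(2) by (metis uniformly_separatedE)
  then obtain m where "dist (F m p) z < \<delta>"
    using z(2) unfolding accumulates_at_def by blast
  then have "dist p (F (- m) z) < \<epsilon>"
    using \<delta>(2)[of "F (- m) z" m] z(1) closed by simp
  then show "\<exists>n. dist (F n z) p < \<epsilon>"
    by (metis dist_commute)
qed

lemma accumulates_at_sequence:
  assumes "accumulates_at x p"
  obtains n :: "nat \<Rightarrow> int" where "(\<lambda>k. F (n k) x) \<longlonglongrightarrow> p"
proof -
  have "\<forall>k::nat. \<exists>n. dist (F n x) p < 1 / Suc k"
    using assms unfolding accumulates_at_def by simp
  then obtain n where n: "\<And>k::nat. dist (F (n k) x) p < 1 / Suc k"
    by metis
  have "(\<lambda>k. dist (F (n k) x) p) \<longlonglongrightarrow> 0"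
  proof (rule Lim_null_comparison)
    show "\<forall>\<^sub>F k in sequentially. norm (dist (F (n k) x) p) \<le> 1 / Suc k"
      by (rule eventuallyI) (use n in \<open>simp add: less_imp_le\<close>)
    show "(\<lambda>k. 1 / real (Suc k)) \<longlonglongrightarrow> 0"
      using LIMSEQ_inverse_real_of_nat by (simp add: inverse_eq_divide)
  qed
  then show ?thesis
    using that tendsto_dist_iff by blast
qed

lemma compact_sequence:
  assumes "\<And>k::nat. s k \<in> X"
  obtains l r where "l \<in> X" "strict_mono r" "(\<lambda>k. s (r k)) \<longlonglongrightarrow> l"
  using compact_X assms unfolding compact_def comp_def by metis

lemma proximal_if_common_limit:
  assumes "(\<lambda>k::nat. F (n k) x) \<longlonglongrightarrow> z" "(\<lambda>k. F (n k) y) \<longlonglongrightarrow> z"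
  shows "proximal x y"
  unfolding proximal_def
proof (intro allI impI)
  fix \<epsilon> :: real assume "\<epsilon> > 0"
  have "(\<lambda>k. dist (F (n k) x) (F (n k) y)) \<longlonglongrightarrow> dist z z"
    using assms by (rule tendsto_dist)
  then have "\<forall>\<^sub>F k in sequentially. dist (F (n k) x) (F (n k) y) < \<epsilon>"
    using \<open>\<epsilon> > 0\<close> by (simp add: order_tendstoD(2))
  then show "\<exists>n. dist (F n x) (F n y) < \<epsilon>"
    by (auto dest: eventually_happens)
qed

text \<open>Separation is used at time \<open>- n k\<close> for the point \<open>F (n k) y\<close>,
  whose image at that time is \<open>y\<close>, the limit of \<open>F (- n k) p\<close>.\<close>

lemma uniformly_separated_limit:
  assumes p: "p \<in> X" "uniformly_separated p" and "y \<in> X"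
    and lim: "(\<lambda>k::nat. F (- n k) p) \<longlonglongrightarrow> y"
  shows "(\<lambda>k. F (n k) y) \<longlonglongrightarrow> p"
proof (rule tendstoI)
  fix \<epsilon> :: real assume "\<epsilon> > 0"
  then obtain \<delta> where \<delta>: "\<delta> > 0"
    "\<And>n y. y \<in> X \<Longrightarrow> dist (F n p) (F n y) < \<delta> \<Longrightarrow> dist p y < \<epsilon>"
    using p(2) by (metis uniformly_separatedE)
  have "\<forall>\<^sub>F k in sequentially. dist (F (- n k) p) y < \<delta>"
    using lim \<delta>(1) by (rule tendstoD)
  then show "\<forall>\<^sub>F k in sequentially. dist (F (n k) y) p < \<epsilon>"
  proof eventually_elim
    case (elim k)
    then have "dist p (F (n k) y) < \<epsilon>"
      using \<delta>(2)[of "F (n k) y" "- n k"] \<open>y \<in> X\<close> closed by simp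
    then show ?case by (simp add: dist_commute)
  qed
qed

lemma distal_accumulates_at_sym:
  assumes p: "p \<in> X" "uniformly_separated p" and distal
    and x: "x \<in> X" "accumulates_at x p"
  shows "accumulates_at p x"
proof -
  obtain n where n: "(\<lambda>k::nat. F (n k) x) \<longlonglongrightarrow> p"
    using accumulates_at_sequence[OF x(2)] .
  obtain y r where y: "y \<in> X" and r: "strict_mono r" and lim: "(\<lambda>k. F (- n (r k)) p) \<longlonglongrightarrow> y"
    using compact_sequence[of "\<lambda>k. F (- n k) p"] closed p(1) by auto
  have "(\<lambda>k. F (n (r k)) y) \<longlonglongrightarrow> p"
    using uniformly_separated_limit[OF p y lim] .
  moreover have "(\<lambda>k. F (n (r k)) x) \<longlonglongrightarrow> p"
    using LIMSEQ_subseq_LIMSEQ[OF n r] by (simp add: comp_def)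
  ultimately have "proximal x y"
    by (intro proximal_if_common_limit)
  \<comment> \<open>The limit of the backward images of \<open>p\<close> is therefore
    \<open>x\<close> itself, which puts \<open>x\<close> in the orbit closure of
    \<open>p\<close>.\<close>
  then have "x = y"
    using \<open>distal\<close> x(1) y unfolding distal_def by blast
  show ?thesis
    unfolding accumulates_at_def
  proof (intro allI impI)
    fix \<epsilon> :: real assume "\<epsilon> > 0"
    with lim \<open>x = y\<close> have "\<forall>\<^sub>F k in sequentially. dist (F (- n (r k)) p) x < \<epsilon>"
      by (simp add: tendstoD)
    then show "\<exists>n. dist (F n p) x < \<epsilon>"
      by (auto dest: eventually_happens)
  qed
qed

section \<open>Regional proximality and equicontinuity\<close>

lemma regionally_proximal_uniformly_separated:
  assumes p: "p \<in> X" "uniformly_separated p" and dense: "\<And>y. y \<in> X \<Longrightarrow> accumulates_at p y"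
    and y: "regionally_proximal p y"
  shows "y = p"
proof (rule ccontr)
  assume "y \<noteq> p"
  \<comment> \<open>It suffices to bring \<open>p\<close> and \<open>y\<close> both within
    \<open>\<epsilon>\<close> of a common point \<open>v\<close>. Separation is used at two scales:
    \<open>\<delta>1\<close> pulls closeness back to \<open>p\<close>, and \<open>\<delta>0\<close>
    carries closeness of \<open>F (- m) p\<close> and \<open>F (- m) v\<close> over to
    \<open>p\<close> and \<open>v\<close>.\<close>
  define \<epsilon> where "\<epsilon> = dist p y / 2"
  have "\<epsilon> > 0"
    using \<open>y \<noteq> p\<close> unfolding \<epsilon>_def by simp
  obtain \<delta>0 where \<delta>0: "\<delta>0 > 0"
    "\<And>n y. y \<in> X \<Longrightarrow> dist (F n p) (F n y) < \<delta>0 \<Longrightarrow> dist p y < \<epsilon>"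
    using uniformly_separatedE[OF p(2) \<open>\<epsilon> > 0\<close>] by metis
  \<comment> \<open>Halved because \<open>F (- m) p\<close> and \<open>w\<close> will both be
    compared with \<open>p\<close>, and the two errors add up.\<close>
  have "\<delta>0 / 2 > 0"
    using \<delta>0(1) by simp
  obtain \<delta>1 where \<delta>1: "\<delta>1 > 0"
    "\<And>n y. y \<in> X \<Longrightarrow> dist (F n p) (F n y) < \<delta>1 \<Longrightarrow> dist p y < \<delta>0 / 2"
    using uniformly_separatedE[OF p(2) \<open>\<delta>0 / 2 > 0\<close>] by metis
  have "min (\<delta>1 / 2) \<epsilon> > 0"
    using \<delta>1(1) \<open>\<epsilon> > 0\<close> by simp
  then obtain u v n where uv: "u \<in> X" "v \<in> X"
    and u: "dist u p < min (\<delta>1 / 2) \<epsilon>" and v: "dist v y < min (\<delta>1 / 2) \<epsilon>"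
    and n: "dist (F n u) (F n v) < min (\<delta>1 / 2) \<epsilon>"
    using y unfolding regionally_proximal_def by meson
  \<comment> \<open>The point \<open>u\<close> will be replaced by some \<open>F m p\<close>;
    \<open>\<eta>\<close> keeps the replacement harmless after the fixed iterate
    \<open>n\<close>.\<close>
  obtain \<eta> where \<eta>: "\<eta> > 0" "\<And>w. w \<in> X \<Longrightarrow> dist w u < \<eta> \<Longrightarrow> dist (F n w) (F n u) < \<delta>1 / 2"
    using cont_at[OF uv(1), of "\<delta>1 / 2" n] \<delta>1(1) by auto
  have "min \<eta> (\<delta>1 / 2) > 0"
    using \<eta>(1) \<delta>1(1) by simp
  then obtain m where m: "dist (F m p) u < min \<eta> (\<delta>1 / 2)"
    using dense[OF uv(1)] unfolding accumulates_at_def by blast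
  \<comment> \<open>With \<open>u\<close> replaced by \<open>F m p\<close>, the pair
    \<open>(F m p, v)\<close> is the image of \<open>(p, w)\<close> under \<open>F m\<close>, so
    separation at \<open>p\<close> applies to \<open>w\<close> at time \<open>n + m\<close>.\<close>
  define w where "w = F (- m) v"
  have w: "w \<in> X" "F m w = v"
    using uv(2) closed unfolding w_def by auto
  have "dist (F m p) p < \<delta>1"
    using m u dist_triangle[of "F m p" p u] by linarith
  then have "dist p (F (- m) p) < \<delta>0 / 2"
    using \<delta>1(2)[of "F (- m) p" m] p(1) closed by simp
  moreover have "dist p w < \<delta>0 / 2"
  proof (rule \<delta>1(2)[of w "n + m"])
    have "dist (F n (F m p)) (F n u) < \<delta>1 / 2"
      using \<eta>(2) m p(1) closed by simp
    then have "dist (F n (F m p)) (F n v) < \<delta>1"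
      using n dist_triangle[of "F n (F m p)" "F n v" "F n u"] by linarith
    then show "dist (F (n + m) p) (F (n + m) w) < \<delta>1"
      using add p(1) w by simp
  qed (fact w(1))
  ultimately have "dist (F (- m) p) w < \<delta>0"
    using dist_triangle3[of "F (- m) p" w p] by linarith
  \<comment> \<open>Separation at the negative time \<open>- m\<close>, applied to \<open>v\<close>,
    whose image is \<open>w\<close>.\<close>
  then have "dist p v < \<epsilon>"
    using \<delta>0(2)[of v "- m"] uv(2) unfolding w_def by simp
  then have "dist p y < 2 * \<epsilon>"
    using v dist_triangle[of p y v] by linarith
  then show False
    unfolding \<epsilon>_def by simp
qed

text \<open>The relation is invariant and closed: witnesses near \<open>(x, y)\<close> are
  transported by one fixed iterate \<open>F (n k)\<close>, continuous at both points, with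
  \<open>k\<close> so large that the images of \<open>x\<close> and \<open>y\<close> are near the
  limits.\<close>

lemma regionally_proximal_limit:
  assumes xy: "x \<in> X" "y \<in> X" "regionally_proximal x y"
    and lim: "(\<lambda>k::nat. F (n k) x) \<longlonglongrightarrow> x'" "(\<lambda>k. F (n k) y) \<longlonglongrightarrow> y'"
  shows "regionally_proximal x' y'"
  unfolding regionally_proximal_def
proof (intro allI impI)
  fix \<epsilon> :: real assume "\<epsilon> > 0"
  then have "\<epsilon> / 2 > 0" by simp
  have "\<forall>\<^sub>F k in sequentially. dist (F (n k) x) x' < \<epsilon> / 2 \<and> dist (F (n k) y) y' < \<epsilon> / 2"
    using lim \<open>\<epsilon> / 2 > 0\<close> by (intro eventually_conj tendstoD)
  then obtain k where k: "dist (F (n k) x) x' < \<epsilon> / 2" "dist (F (n k) y) y' < \<epsilon> / 2"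
    by (auto dest: eventually_happens)
  obtain \<delta>x where \<delta>x: "\<delta>x > 0"
    "\<And>u. u \<in> X \<Longrightarrow> dist u x < \<delta>x \<Longrightarrow> dist (F (n k) u) (F (n k) x) < \<epsilon> / 2"
    using cont_at[OF xy(1) \<open>\<epsilon> / 2 > 0\<close>] by metis
  obtain \<delta>y where \<delta>y: "\<delta>y > 0"
    "\<And>u. u \<in> X \<Longrightarrow> dist u y < \<delta>y \<Longrightarrow> dist (F (n k) u) (F (n k) y) < \<epsilon> / 2"
    using cont_at[OF xy(2) \<open>\<epsilon> / 2 > 0\<close>] by metis
  have "min \<epsilon> (min \<delta>x \<delta>y) > 0"
    using \<open>\<epsilon> > 0\<close> \<delta>x(1) \<delta>y(1) by simp
  then obtain u v m where uv: "u \<in> X" "v \<in> X"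
    and u: "dist u x < min \<epsilon> (min \<delta>x \<delta>y)" and v: "dist v y < min \<epsilon> (min \<delta>x \<delta>y)"
    and m: "dist (F m u) (F m v) < min \<epsilon> (min \<delta>x \<delta>y)"
    using xy(3) unfolding regionally_proximal_def by meson
  have "dist (F (n k) u) x' < \<epsilon>"
    using \<delta>x(2)[OF uv(1)] u k(1) dist_triangle[of "F (n k) u" x' "F (n k) x"] by auto
  moreover have "dist (F (n k) v) y' < \<epsilon>"
    using \<delta>y(2)[OF uv(2)] v k(2) dist_triangle[of "F (n k) v" y' "F (n k) y"] by auto
  \<comment> \<open>Shifting the time to \<open>m - n k\<close> undoes the transport, so the pair
    reached is still \<open>(F m u, F m v)\<close>.\<close>
  moreover have "dist (F (m - n k) (F (n k) u)) (F (m - n k) (F (n k) v)) < \<epsilon>"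
    using m uv add[of _ "m - n k" "n k"] by simp
  ultimately show "\<exists>u\<in>X. \<exists>v\<in>X. \<exists>n. dist u x' < \<epsilon> \<and> dist v y' < \<epsilon> \<and> dist (F n u) (F n v) < \<epsilon>"
    using uv closed by blast
qed

lemma regionally_proximal_trivial:
  assumes p: "p \<in> X" "uniformly_separated p" and dense: "\<And>y. y \<in> X \<Longrightarrow> accumulates_at p y"
    and distal and xy: "x \<in> X" "y \<in> X" "regionally_proximal x y"
  shows "x = y"
proof -
  \<comment> \<open>Density gives \<open>x\<close> in the orbit closure of \<open>p\<close>;
    recurrence reverses this, so \<open>x\<close> can be driven to \<open>p\<close>.\<close>
  obtain n where n: "(\<lambda>k::nat. F (n k) x) \<longlonglongrightarrow> p"
    using accumulates_at_sequence uniformly_separated_recurrent[OF p xy(1) dense[OF xy(1)]] .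
  obtain y' r where "y' \<in> X" and r: "strict_mono r" and y': "(\<lambda>k. F (n (r k)) y) \<longlonglongrightarrow> y'"
    using compact_sequence[of "\<lambda>k. F (n k) y"] closed xy(2) by auto
  have x': "(\<lambda>k. F (n (r k)) x) \<longlonglongrightarrow> p"
    using LIMSEQ_subseq_LIMSEQ[OF n r] by (simp add: comp_def)
  have "y' = p"
    using regionally_proximal_uniformly_separated[OF p dense]
      regionally_proximal_limit[OF xy x' y'] by blast
  then have "proximal x y"
    using x' y' by (auto intro: proximal_if_common_limit)
  then show ?thesis
    using \<open>distal\<close> xy unfolding distal_def by blast
qed

text \<open>If pairs approach each other while their images at times \<open>n k\<close> stay more
  than \<open>\<epsilon>\<close> apart, compactness gives distinct limits \<open>a\<close> and
  \<open>b\<close> of the images. Returning by \<open>- n k\<close> makes the images close again, so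
  \<open>a\<close> and \<open>b\<close> are regionally proximal.\<close>

lemma equicontinuous_if_regionally_proximal_trivial:
  assumes triv: "\<And>x y. x \<in> X \<Longrightarrow> y \<in> X \<Longrightarrow> regionally_proximal x y \<Longrightarrow> x = y" and "\<epsilon> > 0"
  shows "\<exists>\<delta>>0. \<forall>x\<in>X. \<forall>y\<in>X. dist x y \<le> \<delta> \<longrightarrow> (\<forall>n. dist (F n x) (F n y) \<le> \<epsilon>)"
proof (rule ccontr)
  assume neg: "\<not> ?thesis"
  have "\<exists>x y n. x \<in> X \<and> y \<in> X \<and> dist x y \<le> 1 / Suc k \<and> dist (F n x) (F n y) > \<epsilon>" for k :: nat
  proof -
    have "1 / real (Suc k) > 0" by simp
    with neg show ?thesis by (meson not_le)
  qed
  then obtain x y n where xy: "\<And>k::nat. x k \<in> X" "\<And>k. y k \<in> X"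
    and close: "\<And>k. dist (x k) (y k) \<le> 1 / Suc k"
    and far: "\<And>k. dist (F (n k) (x k)) (F (n k) (y k)) > \<epsilon>"
    by metis
  obtain a r where a: "a \<in> X" "strict_mono r" "(\<lambda>k. F (n (r k)) (x (r k))) \<longlonglongrightarrow> a"
    using compact_sequence[of "\<lambda>k. F (n k) (x k)"] closed xy(1) by auto
  obtain b s where b: "b \<in> X" "strict_mono s" "(\<lambda>k. F (n (r (s k))) (y (r (s k)))) \<longlonglongrightarrow> b"
    using compact_sequence[of "\<lambda>k. F (n (r k)) (y (r k))"] closed xy(2) by auto
  have a': "(\<lambda>k. F (n (r (s k))) (x (r (s k)))) \<longlonglongrightarrow> a"
    using LIMSEQ_subseq_LIMSEQ[OF a(3) b(2)] by (simp add: comp_def)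
  have "(\<lambda>k. dist (F (n (r (s k))) (x (r (s k)))) (F (n (r (s k))) (y (r (s k))))) \<longlonglongrightarrow> dist a b"
    using a' b(3) by (rule tendsto_dist)
  then have "\<epsilon> \<le> dist a b"
    by (rule LIMSEQ_le_const) (use far less_imp_le in blast)
  then have "a \<noteq> b"
    using \<open>\<epsilon> > 0\<close> by auto
  moreover have "regionally_proximal a b"
    unfolding regionally_proximal_def
  proof (intro allI impI)
    fix \<eta> :: real assume "\<eta> > 0"
    have "(\<lambda>k. 1 / real (Suc k)) \<longlonglongrightarrow> 0"
      using LIMSEQ_inverse_real_of_nat by (simp add: inverse_eq_divide)
    then have "(\<lambda>k. 1 / real (Suc (r (s k)))) \<longlonglongrightarrow> 0"
      using LIMSEQ_subseq_LIMSEQ[OF _ strict_mono_o[OF a(2) b(2)]] by (fastforce simp: comp_def)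
    then have "\<forall>\<^sub>F k in sequentially. 1 / real (Suc (r (s k))) < \<eta>"
      using \<open>\<eta> > 0\<close> by (rule order_tendstoD(2))
    then have "\<forall>\<^sub>F k in sequentially. dist (F (n (r (s k))) (x (r (s k)))) a < \<eta> \<and>
        dist (F (n (r (s k))) (y (r (s k)))) b < \<eta> \<and> 1 / real (Suc (r (s k))) < \<eta>"
      using a' b(3) \<open>\<eta> > 0\<close> by (intro eventually_conj tendstoD)
    then obtain j where j: "dist (F (n j) (x j)) a < \<eta>" "dist (F (n j) (y j)) b < \<eta>"
        "1 / real (Suc j) < \<eta>"
      by (auto dest: eventually_happens)
    \<comment> \<open>The witnesses are the images; time \<open>- n j\<close> leads back to the
      close pair \<open>x j\<close>, \<open>y j\<close>.\<close>
    moreover have "dist (F (- n j) (F (n j) (x j))) (F (- n j) (F (n j) (y j))) < \<eta>"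
      using close[of j] j(3) xy by simp
    ultimately show "\<exists>u\<in>X. \<exists>v\<in>X. \<exists>n. dist u a < \<eta> \<and> dist v b < \<eta> \<and> dist (F n u) (F n v) < \<eta>"
      using closed xy by blast
  qed
  ultimately show False
    using triv a(1) b(1) by blast
qed

text \<open>The dense orbit is that of \<open>x\<close>, while separation holds at \<open>p\<close>;
  density passes to \<open>p\<close> because \<open>p\<close> accumulates at \<open>x\<close> and
  \<open>x\<close> at every point.\<close>

lemma distal_transitive_equicontinuous:
  assumes p: "p \<in> X" "uniformly_separated p" and distal
    and x: "x \<in> X" "\<And>y. y \<in> X \<Longrightarrow> accumulates_at x y" and "\<epsilon> > 0"
  shows "\<exists>\<delta>>0. \<forall>x\<in>X. \<forall>y\<in>X. dist x y \<le> \<delta> \<longrightarrow> (\<forall>n. dist (F n x) (F n y) \<le> \<epsilon>)"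
proof -
  have "accumulates_at p y" if "y \<in> X" for y
    using accumulates_at_trans[OF p(1) x(1) _ x(2)[OF that]]
      distal_accumulates_at_sym[OF p \<open>distal\<close> x(1) x(2)[OF p(1)]] by blast
  then show ?thesis
    using equicontinuous_if_regionally_proximal_trivial[OF _ \<open>\<epsilon> > 0\<close>]
      regionally_proximal_trivial[OF p _ \<open>distal\<close>] by blast
qed

end

section \<open>The iterates of a homeomorphism form such an action\<close>

lemma int_iterate_action:
  assumes "compact X" "homeomorphism X X f g"
  shows "compact_int_action X (int_iterate X f)"
proof
  let ?F = "int_iterate X f" and ?h = "inv_into X f"
  have inj: "inj_on f X"
    using assms(2) unfolding homeomorphism_def by (metis inj_on_inverseI)
  have img: "f ` X = X" and gX: "g ` X = X"
    using assms(2) unfolding homeomorphism_def by auto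
  \<comment> \<open>Agreement with \<open>g\<close> on \<open>X\<close> is what makes
    \<open>?h\<close> continuous there.\<close>
  have hg: "?h x = g x" if "x \<in> X" for x
    using that assms(2) inj gX by (metis homeomorphism_apply2 imageI inv_into_f_f)
  have fX: "f x \<in> X" and hX: "?h x \<in> X" and fh: "f (?h x) = x" and hf: "?h (f x) = x"
    if "x \<in> X" for x
    using that img inj by (auto intro: inv_into_into f_inv_into_f)
  have pos: "?F (int k) = f ^^ k" and neg: "?F (- int k) = ?h ^^ k" for k
    by (simp_all add: int_iterate_def)
  have fpow: "(f ^^ k) x \<in> X" and hpow: "(?h ^^ k) x \<in> X" if "x \<in> X" for x k
    by (induction k) (use that fX hX in auto)
  have FX: "?F n x \<in> X" if "x \<in> X" for n x
    using that fpow hpow by (simp add: int_iterate_def)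
  \<comment> \<open>The one-step recursions \<open>succ\<close> and \<open>pred\<close> drive the
    two-sided induction on \<open>m\<close> that proves the group law.\<close>
  have succ: "?F (n + 1) x = f (?F n x)" if "x \<in> X" for n x
  proof (cases "n \<ge> 0")
    case True
    then obtain k where "n = int k" using nonneg_int_cases by blast
    then show ?thesis using pos[of "Suc k"] pos[of k] by (simp add: add.commute)
  next
    case False
    \<comment> \<open>Writing \<open>n\<close> as \<open>- int (Suc k)\<close> exposes an outermost
      \<open>?h\<close>, which \<open>f\<close> cancels.\<close>
    then obtain k where k: "n = - int (Suc k)"
      by (metis int_cases of_nat_0_le_iff)
    have "n + 1 = - int k" using k by simp
    then show ?thesis
      using neg[of k] neg[of "Suc k"] k fh[OF hpow[OF that]] by simp
  qed
  have pred: "?F (n - 1) x = ?h (?F n x)" if "x \<in> X" for n x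
    using succ[OF that, of "n - 1"] hf FX[OF that] by simp
  show "compact X" by fact
  show "?F 0 x = x" for x
    by (simp add: int_iterate_def)
  show "?F n x \<in> X" if "x \<in> X" for n x
    using FX that .
  show "?F (m + n) x = ?F m (?F n x)" if "x \<in> X" for m n x
  proof (induction m rule: int_induct[of _ 0])
    case base
    show ?case by (simp add: int_iterate_def)
  next
    case (step1 i)
    then show ?case
      using succ[OF that, of "i + n"] succ[OF FX[OF that], of i] by (simp add: algebra_simps)
  next
    case (step2 i)
    then show ?case
      using pred[OF that, of "i + n"] pred[OF FX[OF that], of i] by (simp add: algebra_simps)
  qed
  have cf: "continuous_on X f" and ch: "continuous_on X ?h"
    using assms(2) hg unfolding homeomorphism_def by (auto cong: continuous_on_cong)
  have pow: "continuous_on X (q ^^ k)" if "continuous_on X q" "q ` X \<subseteq> X" for q :: "'a \<Rightarrow> 'a" and k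
  proof (induction k)
    case 0
    show ?case by (simp add: id_def)
  next
    case (Suc k)
    have "(q ^^ k) ` X \<subseteq> X" for k
      by (induction k) (use that(2) in auto)
    then show ?case
      using continuous_on_compose[OF Suc continuous_on_subset[OF that(1)]] by (simp add: comp_def)
  qed
  show "continuous_on X (?F n)" for n
    using pow[OF cf] pow[OF ch] fX hX by (auto simp: int_iterate_def image_subset_iff)
qed

section \<open>Consequences of property (CW)\<close>

lemma property_CW_distance:
  assumes "property_CW X f" "x \<in> X" "subcontinuum X C" "x \<notin> C"
  obtains \<delta> where "\<delta> > 0"
    "\<And>n y. y \<in> C \<Longrightarrow> \<delta> \<le> dist (int_iterate X f n x) (int_iterate X f n y)"
proof
  let ?D = "\<lambda>n. infdist (int_iterate X f n x) (int_iterate X f n ` C)"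
  \<comment> \<open>The infimum itself is the witness for \<open>\<delta>\<close>, uniform in
    \<open>n\<close> and in the points of \<open>C\<close>.\<close>
  show "(INF n. ?D n) > 0"
    using assms unfolding property_CW_def by blast
  fix n y assume "y \<in> C"
  have "bdd_below (range ?D)"
    by (rule bdd_belowI2[of _ 0]) (simp add: infdist_nonneg)
  then have "(INF n. ?D n) \<le> ?D n"
    by (rule cINF_lower) simp
  also have "\<dots> \<le> dist (int_iterate X f n x) (int_iterate X f n y)"
    using \<open>y \<in> C\<close> by (intro infdist_le) simp
  finally show "(INF n. ?D n) \<le> dist (int_iterate X f n x) (int_iterate X f n y)" .
qed

lemma property_CW_distal:
  assumes "compact_int_action X (int_iterate X f)" "property_CW X f"
  shows "compact_int_action.distal X (int_iterate X f)"
proof -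
  interpret compact_int_action X "int_iterate X f" by fact
  show ?thesis
    unfolding distal_def proximal_def
  proof (intro ballI impI, rule ccontr)
    fix x y assume xy: "x \<in> X" "y \<in> X" "x \<noteq> y"
      and prox: "\<forall>\<epsilon>>0. \<exists>n. dist (int_iterate X f n x) (int_iterate X f n y) < \<epsilon>"
    have "subcontinuum X {y}" "x \<notin> {y}"
      using xy by (auto simp: subcontinuum_def)
    then obtain \<delta> where "\<delta> > 0"
      and far: "\<And>n. \<delta> \<le> dist (int_iterate X f n x) (int_iterate X f n y)"
      using property_CW_distance[OF assms(2) xy(1), of "{y}"] by (metis singletonI)
    obtain n where "dist (int_iterate X f n x) (int_iterate X f n y) < \<delta>"
      using prox \<open>\<delta> > 0\<close> by blast
    then show False
      using far[of n] by linarith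
  qed
qed

lemma property_CW_uniformly_separated:
  assumes "compact_int_action X (int_iterate X f)" "property_CW X f" "p \<in> slc_points X"
  shows "compact_int_action.uniformly_separated X (int_iterate X f) p"
proof -
  interpret compact_int_action X "int_iterate X f" by fact
  have p: "p \<in> X" "semi_locally_connected_at X p"
    using assms(3) by (auto simp: slc_points_def)
  show ?thesis
    unfolding uniformly_separated_def
  proof (intro allI impI)
    fix \<epsilon> :: real assume "\<epsilon> > 0"
    have "openin (top_of_set X) (X \<inter> ball p \<epsilon>)" "p \<in> X \<inter> ball p \<epsilon>"
      using p(1) \<open>\<epsilon> > 0\<close> by (auto simp: openin_open_Int)
    then obtain V \<F> where V: "openin (top_of_set X) V" "p \<in> V"
      and \<F>: "finite \<F>" "\<F> \<subseteq> components (X - V)" "X - X \<inter> ball p \<epsilon> \<subseteq> \<Union>\<F>"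
      using p(2) unfolding semi_locally_connected_at_def by metis
    obtain W where W: "open W" "V = X \<inter> W"
      using V(1) unfolding openin_open by blast
    \<comment> \<open>Removing an open set leaves a compact set; its components are closed in it,
      hence compact, and they avoid \<open>p\<close> since \<open>p\<close> lies in
      \<open>V\<close>.\<close>
    have "X - V = X - W"
      using W(2) by blast
    then have "compact (X - V)"
      using compact_diff[OF compact_X W(1)] by simp
    then have "subcontinuum X C \<and> p \<notin> C" if "C \<in> \<F>" for C
      using that \<F>(2) V(2) in_components_subset[of C "X - V"] in_components_nonempty[of C "X - V"]
        in_components_connected[of C "X - V"] closedin_compact[OF _ closedin_component]
      unfolding subcontinuum_def by blast
    then have "\<exists>\<delta>>0. \<forall>n. \<forall>y\<in>C. \<delta> \<le> dist (int_iterate X f n p) (int_iterate X f n y)"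
      if "C \<in> \<F>" for C
      using property_CW_distance[OF assms(2) p(1), of C] that by metis
    then obtain d where d: "\<And>C. C \<in> \<F> \<Longrightarrow> d C > 0"
      "\<And>C n y. C \<in> \<F> \<Longrightarrow> y \<in> C \<Longrightarrow> d C \<le> dist (int_iterate X f n p) (int_iterate X f n y)"
      by metis
    \<comment> \<open>The extra \<open>1\<close> keeps the minimum meaningful when
      \<open>\<F>\<close> is empty, as can happen if the ball contains all of
      \<open>X\<close>.\<close>
    define \<delta> :: real where "\<delta> = Min (insert 1 (d ` \<F>))"
    have "\<delta> > 0"
      using d(1) \<F>(1) unfolding \<delta>_def by (subst Min_gr_iff) auto
    have "dist p y < \<epsilon>"
      if y: "y \<in> X" "dist (int_iterate X f n p) (int_iterate X f n y) < \<delta>" for n y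
    proof (rule ccontr)
      assume "\<not> dist p y < \<epsilon>"
      then obtain C where C: "C \<in> \<F>" "y \<in> C"
        using y(1) \<F>(3) by auto
      have "\<delta> \<le> d C"
        using C(1) \<F>(1) unfolding \<delta>_def by simp
      then show False
        using d(2)[OF C, of n] y(2) by linarith
    qed
    then show "\<exists>\<delta>>0. \<forall>n. \<forall>y\<in>X.
        dist (int_iterate X f n p) (int_iterate X f n y) < \<delta> \<longrightarrow> dist p y < \<epsilon>"
      using \<open>\<delta> > 0\<close> by blast
  qed
qed

section \<open>From equicontinuity back to property (CW)\<close>

lemma equicontinuous_property_CW:
  assumes "compact_int_action X (int_iterate X f)" "equicontinuous_homeo X f"
  shows "property_CW X f"
  unfolding property_CW_def
proof (intro ballI allI impI)
  interpret compact_int_action X "int_iterate X f" by fact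
  fix x C assume x: "x \<in> X" and "subcontinuum X C \<and> x \<notin> C"
  then have C: "C \<subseteq> X" "C \<noteq> {}" "compact C" "x \<notin> C"
    by (auto simp: subcontinuum_def)
  \<comment> \<open>Half the distance, since equicontinuity yields only a weak inequality and a
    contradiction needs a strict one.\<close>
  define \<epsilon> where "\<epsilon> = infdist x C / 2"
  have "\<epsilon> > 0"
    using C infdist_pos_not_in_closed[OF compact_imp_closed] unfolding \<epsilon>_def by auto
  then obtain \<delta> where \<delta>: "\<delta> > 0" "\<And>u v n. u \<in> X \<Longrightarrow> v \<in> X \<Longrightarrow> dist u v \<le> \<delta> \<Longrightarrow>
      dist (int_iterate X f n u) (int_iterate X f n v) \<le> \<epsilon>"
    using assms(2) unfolding equicontinuous_homeo_def by metis
  \<comment> \<open>Equicontinuity is applied to the inverse iterate: if \<open>F n x\<close> and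
    \<open>F n y\<close> were closer than \<open>\<delta>\<close>, then \<open>F (- n)\<close> would
    bring \<open>x\<close> within \<open>\<epsilon>\<close> of \<open>C\<close>.\<close>
  have far: "\<delta> \<le> dist (int_iterate X f n x) (int_iterate X f n y)" if "y \<in> C" for n y
  proof (rule ccontr)
    assume "\<not> ?thesis"
    then have "dist (int_iterate X f (- n) (int_iterate X f n x))
        (int_iterate X f (- n) (int_iterate X f n y)) \<le> \<epsilon>"
      using \<delta>(2) closed x that C(1) by (meson less_imp_le not_le subsetD)
    then have "dist x y \<le> \<epsilon>"
      using x that C(1) inverse(1)[of x n] inverse(1)[of y n] by auto
    then show False
      using infdist_le[OF that, of x] \<open>\<epsilon> > 0\<close> unfolding \<epsilon>_def by linarith
  qed
  have "\<delta> \<le> infdist (int_iterate X f n x) (int_iterate X f n ` C)" for n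
    using C(2) far by (simp add: infdist_notempty) (intro cINF_greatest, auto)
  then have "\<delta> \<le> (INF n. infdist (int_iterate X f n x) (int_iterate X f n ` C))"
    by (intro cINF_greatest) auto
  then show "0 < (INF n. infdist (int_iterate X f n x) (int_iterate X f n ` C))"
    using \<delta>(1) by linarith
qed

theorem corollary1p8:
  fixes X :: "'a::metric_space set" and f :: "'a \<Rightarrow> 'a"
  assumes "compact X"
    and "slc_points X \<noteq> {}"
    and "\<exists>g. homeomorphism X X f g"
    and "transitive_homeo X f"
  shows "property_CW X f \<longleftrightarrow> equicontinuous_homeo X f"
proof
  obtain g where "homeomorphism X X f g"
    using assms(3) by blast
  then have action: "compact_int_action X (int_iterate X f)"
    by (rule int_iterate_action[OF assms(1)])
  then interpret compact_int_action X "int_iterate X f" .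
  show "property_CW X f" if "equicontinuous_homeo X f"
    using equicontinuous_property_CW[OF action that] .
  assume CW: "property_CW X f"
  obtain p where p: "p \<in> slc_points X"
    using assms(2) by blast
  obtain x where x: "x \<in> X" "X \<subseteq> closure (range (\<lambda>n. int_iterate X f n x))"
    using assms(4) unfolding transitive_homeo_def by blast
  have "accumulates_at x y" if "y \<in> X" for y
    using that x(2) unfolding accumulates_at_def by (auto simp: closure_approachable)
  then show "equicontinuous_homeo X f"
    unfolding equicontinuous_homeo_def
    using distal_transitive_equicontinuous[OF _ property_CW_uniformly_separated[OF action CW p]
        property_CW_distal[OF action CW] x(1)] p
    by (simp add: slc_points_def)
qed

end
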